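(* The following assertion is false. Assertion: Let $\mathcal{G}$ be any causal structure and $(\mathcal{H},\Psi)$ any consistent state assignment for $\mathcal{G}$. Let $n\ge 2$ and let $A_1,\ldots,A_n$ be edges of $\mathcal{G}$ with $A_i\neq A_{i+1}$ for all $1\le i<n$ and $A_1\ne A_n$. Suppose that for each $1\le i<n$ there is a spacelike surface of $\mathcal{G}$ containing both $A_i$ and $A_{i+1}$, and that there is a spacelike surface containing both $A_1$ and $A_n$. Then for every $\phi\in\mathcal{H}_{A_1}$, if $\Psi^{A_{n-1}\rightarrow A_n}\circ\cdots\circ\Psi^{A_1\rightarrow A_2}(\phi)$ is defined and pure, it is equal to $\Psi^{A_1\rightarrow A_n}(\phi)$. That is, there exist $\mathcal{G}$, $(\mathcal{H},\Psi)$, $A_1,\ldots,A_n$ and $\phi$ satisfying all the hypotheses for which the iterated relative state is defined and pure but is not equal to $\Psi^{A_1\rightarrow A_n}(\phi)$.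
   Context: **Causal structure.** A causal structure is a finite directed acyclic graph in which each edge is allowed to have both a source and a target, only a source, only a target, or neither. Parallel edges are allowed. For a vertex $v$, the inputs of $v$ are the edges with target $v$, and the outputs of $v$ are the edges with source $v$. **Spacelike surfaces.** For a causal structure $\mathcal{G}$, let $S_0$ be the set of edges with no source. The spacelike surfaces of $\mathcal{G}$ are the sets of edges defined inductively: $S_0$ is a spacelike surface; if $S$ is a spacelike surface and $v$ is a vertex all of whose inputs lie in $S$, then the set obtained from $S$ by removing the inputs of $v$ and adding the outputs of $v$ is a spacelike surface; there are no others. **Consistent state assignment.** A consistent state assignment for $\mathcal{G}$ is a pair $(\mathcal{H},\Psi)$ as follows. $\mathcal{H}$ assigns to each edge a finite-dimensional complex Hilbert space such that, for each vertex $v$, the product of the dimensions of the spaces assigned to the inputs of $v$ equals the product of the dimensions of the spaces assigned to the outputs of $v$. For a subset $\mathcal{A}$ of a spacelike surface, $\mathcal{H}_{\mathcal{A}}$ denotes the tensor product of the spaces assigned to the edges in $\mathcal{A}$ (and $\mathcal{H}_A=\mathcal{H}_{\{A\}}$). $\Psi$ assigns to each spacelike surface $S$ a unit vector $\Psi_S\in\mathcal{H}_S$ such that for any two spacelike surfaces $S,S'$, the vectors $\Psi_S$ and $\Psi_{S'}$ have identical reduced density operators on $\mathcal{H}_{S\cap S'}$. **Relative state map.** Let $A\ne B$ be edges contained in a common spacelike surface $S$. Define $$\Psi^{A\rightarrow B}(\phi)=\mathcal{N}\,\mathrm{tr}_{S\setminus\{A,B\}}\left[\left(\langle\phi|_A\otimes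 1_B\otimes 1_{S\setminus\{A,B\}}\right)|\Psi_S\rangle\langle\Psi_S|\left(|\phi\rangle_A\otimes 1_B\otimes 1_{S\setminus\{A,B\}}\right)\right],\quad \phi\in\mathcal{H}_A,$$ where $\mathcal{N}$ is the factor normalizing the trace to $1$. The map is undefined at $\phi$ if the unnormalized operator is zero. It does not depend on the choice of $S$. Its value is a density operator on $\mathcal{H}_B$. When this density operator is pure (rank one), it is identified with the corresponding unit vector of $\mathcal{H}_B$ up to phase, so that $\Psi^{A\to B}$ is viewed as a partial function $\mathcal{H}_A\rightarrow\mathcal{H}_B$. A composite of such maps is defined at $\phi$ when every intermediate value is defined and pure and the last map is defined there. Equality of states means equality as density operators (equality of vectors up to phase). *)

theory Defs
  imports "HOL-Analysis.Finite_Product_Measure" Complex_Main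
begin

section \<open>Causal structures and spacelike surfaces\<close>

record ('v, 'e) causal_structure =
  verts :: "'v set"
  edges :: "'e set"
  source :: "'e \<Rightarrow> 'v option"
  target :: "'e \<Rightarrow> 'v option"

definition is_causal_structure :: "('v, 'e) causal_structure \<Rightarrow> bool" where
  "is_causal_structure G \<longleftrightarrow>
     finite (verts G) \<and> finite (edges G) \<and>
     (\<forall>e \<in> edges G. \<forall>v. source G e = Some v \<or> target G e = Some v \<longrightarrow> v \<in> verts G) \<and>
     acyclic {(u, v). \<exists>e \<in> edges G. source G e = Some u \<and> target G e = Some v}"

definition inputs :: "('v, 'e) causal_structure \<Rightarrow> 'v \<Rightarrow> 'e set" where
  "inputs G v = {e \<in> edges G. target G e = Some v}"

definition outputs :: "('v, 'e) causal_structure \<Rightarrow> 'v \<Rightarrow> 'e set" where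
  "outputs G v = {e \<in> edges G. source G e = Some v}"

inductive spacelike_surface :: "('v, 'e) causal_structure \<Rightarrow> 'e set \<Rightarrow> bool"
  for G where
  initial: "spacelike_surface G {e \<in> edges G. source G e = None}"
| step: "spacelike_surface G S \<Longrightarrow> v \<in> verts G \<Longrightarrow> inputs G v \<subseteq> S \<Longrightarrow>
         spacelike_surface G ((S - inputs G v) \<union> outputs G v)"


section \<open>Tensor products of finite-dimensional Hilbert spaces\<close>

text \<open>
  The Hilbert space of an edge \<open>e\<close> is \<open>\<complex>\<close> to the power \<open>d e\<close>, with orthonormal basis labelled by
  \<open>{..<d e}\<close>. The tensor product over a finite set \<open>A\<close> of edges then has the product basis labelled
  by \<open>basis d A\<close>; its vectors are the coefficient functions on that basis and its operators are
  the matrices in that basis, both extended by \<open>0\<close> outside the basis so that equality of vectors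
  and operators is equality of functions. For \<open>A = {}\<close> the space is one-dimensional. The space of
  a single edge \<open>e\<close> is the one of \<open>{e}\<close>.
\<close>

type_synonym 'e vector = "('e \<Rightarrow> nat) \<Rightarrow> complex"
type_synonym 'e oper = "('e \<Rightarrow> nat) \<Rightarrow> ('e \<Rightarrow> nat) \<Rightarrow> complex"

definition basis :: "('e \<Rightarrow> nat) \<Rightarrow> 'e set \<Rightarrow> ('e \<Rightarrow> nat) set" where
  "basis d A = (\<Pi>\<^sub>E e\<in>A. {..<d e})"

definition hilbert :: "('e \<Rightarrow> nat) \<Rightarrow> 'e set \<Rightarrow> 'e vector set" where
  "hilbert d A = {\<psi>. \<forall>x. x \<notin> basis d A \<longrightarrow> \<psi> x = 0}"

definition unit_vector :: "('e \<Rightarrow> nat) \<Rightarrow> 'e set \<Rightarrow> 'e vector \<Rightarrow> bool" where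
  "unit_vector d A \<psi> \<longleftrightarrow> \<psi> \<in> hilbert d A \<and> (\<Sum>x\<in>basis d A. (cmod (\<psi> x))\<^sup>2) = 1"

text \<open>The rank-one operator \<open>|\<psi>\<rangle>\<langle>\<xi>|\<close>.\<close>

definition ketbra :: "'e vector \<Rightarrow> 'e vector \<Rightarrow> 'e oper" where
  "ketbra \<psi> \<xi> = (\<lambda>x y. \<psi> x * cnj (\<xi> y))"

definition op_trace :: "('e \<Rightarrow> nat) \<Rightarrow> 'e set \<Rightarrow> 'e oper \<Rightarrow> complex" where
  "op_trace d A M = (\<Sum>x\<in>basis d A. M x x)"

text \<open>
  For disjoint \<open>T\<close> and \<open>R\<close>, the partial trace over the factors in \<open>R\<close> of an operator on the space
  of \<open>T \<union> R\<close>; the result is an operator on the space of \<open>T\<close>. The basis label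
  \<open>merge T R (x, z)\<close> is \<open>x\<close> on \<open>T\<close> and \<open>z\<close> on \<open>R\<close>.
\<close>

definition partial_trace :: "('e \<Rightarrow> nat) \<Rightarrow> 'e set \<Rightarrow> 'e set \<Rightarrow> 'e oper \<Rightarrow> 'e oper" where
  "partial_trace d T R M = (\<lambda>x y.
     if x \<in> basis d T \<and> y \<in> basis d T
     then \<Sum>z\<in>basis d R. M (merge T R (x, z)) (merge T R (y, z)) else 0)"

definition reduced_density :: "('e \<Rightarrow> nat) \<Rightarrow> 'e set \<Rightarrow> 'e vector \<Rightarrow> 'e set \<Rightarrow> 'e oper" where
  "reduced_density d S \<psi> T = partial_trace d T (S - T) (ketbra \<psi> \<psi>)"

text \<open>
  The vector \<open>(\<langle>\<phi>|\<^sub>A \<otimes> 1)|\<psi>\<rangle>\<close> in the space of \<open>S - {A}\<close>, for \<open>\<psi>\<close> in the space of \<open>S\<close>.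
\<close>

definition apply_bra :: "('e \<Rightarrow> nat) \<Rightarrow> 'e set \<Rightarrow> 'e \<Rightarrow> 'e vector \<Rightarrow> 'e vector \<Rightarrow> 'e vector" where
  "apply_bra d S A \<phi> \<psi> = (\<lambda>x.
     if x \<in> basis d (S - {A})
     then \<Sum>a\<in>basis d {A}. cnj (\<phi> a) * \<psi> (merge {A} (S - {A}) (a, x)) else 0)"


section \<open>Consistent state assignments\<close>

definition consistent_state_assignment ::
  "('v, 'e) causal_structure \<Rightarrow> ('e \<Rightarrow> nat) \<Rightarrow> ('e set \<Rightarrow> 'e vector) \<Rightarrow> bool" where
  "consistent_state_assignment G d \<Psi> \<longleftrightarrow>
     (\<forall>v \<in> verts G. (\<Prod>e\<in>inputs G v. d e) = (\<Prod>e\<in>outputs G v. d e)) \<and>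
     (\<forall>S. spacelike_surface G S \<longrightarrow> unit_vector d S (\<Psi> S)) \<and>
     (\<forall>S S'. spacelike_surface G S \<longrightarrow> spacelike_surface G S' \<longrightarrow>
        reduced_density d S (\<Psi> S) (S \<inter> S') = reduced_density d S' (\<Psi> S') (S \<inter> S'))"


section \<open>Relative states\<close>

definition relative_operator ::
  "('e \<Rightarrow> nat) \<Rightarrow> 'e set \<Rightarrow> 'e vector \<Rightarrow> 'e \<Rightarrow> 'e \<Rightarrow> 'e vector \<Rightarrow> 'e oper" where
  "relative_operator d S \<psi> A B \<phi> =
     partial_trace d {B} (S - {A, B}) (ketbra (apply_bra d S A \<phi> \<psi>) (apply_bra d S A \<phi> \<psi>))"

definition normalize_trace :: "('e \<Rightarrow> nat) \<Rightarrow> 'e set \<Rightarrow> 'e oper \<Rightarrow> 'e oper option" where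
  "normalize_trace d A M =
     (if M = (\<lambda>x y. 0) then None else Some (\<lambda>x y. M x y / op_trace d A M))"

text \<open>
  The relative state map, for \<open>A \<noteq> B\<close> lying on a common spacelike surface; \<open>None\<close> means undefined.
  By \<open>relative_state_eq\<close> below, the choice of the surface is immaterial.
\<close>

definition relative_state ::
  "('v, 'e) causal_structure \<Rightarrow> ('e \<Rightarrow> nat) \<Rightarrow> ('e set \<Rightarrow> 'e vector) \<Rightarrow>
   'e \<Rightarrow> 'e \<Rightarrow> 'e vector \<Rightarrow> 'e oper option" where
  "relative_state G d \<Psi> A B \<phi> =
     (let S = (SOME S. spacelike_surface G S \<and> A \<in> S \<and> B \<in> S)
      in normalize_trace d {B} (relative_operator d S (\<Psi> S) A B \<phi>))"

text \<open>
  The density operator \<open>\<rho>\<close> is pure, with corresponding unit vector \<open>\<xi>\<close> (unique up to phase).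
\<close>

definition pure_with_vector :: "('e \<Rightarrow> nat) \<Rightarrow> 'e set \<Rightarrow> 'e oper \<Rightarrow> 'e vector \<Rightarrow> bool" where
  "pure_with_vector d A \<rho> \<xi> \<longleftrightarrow> unit_vector d A \<xi> \<and> \<rho> = ketbra \<xi> \<xi>"

definition pure :: "('e \<Rightarrow> nat) \<Rightarrow> 'e set \<Rightarrow> 'e oper \<Rightarrow> bool" where
  "pure d A \<rho> \<longleftrightarrow> (\<exists>\<xi>. pure_with_vector d A \<rho> \<xi>)"

text \<open>
  \<open>iterated_relative_state G d \<Psi> [A\<^sub>1, \<dots>, A\<^sub>n] \<phi> \<rho>\<close>: the composite of the relative state maps
  along \<open>A\<^sub>1, \<dots>, A\<^sub>n\<close> is defined at \<open>\<phi>\<close> with value \<open>\<rho>\<close>. Every intermediate value has to be pure,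
  and any of its unit vectors, which differ by a phase only, may be passed on.
\<close>

inductive iterated_relative_state ::
  "('v, 'e) causal_structure \<Rightarrow> ('e \<Rightarrow> nat) \<Rightarrow> ('e set \<Rightarrow> 'e vector) \<Rightarrow>
   'e list \<Rightarrow> 'e vector \<Rightarrow> 'e oper \<Rightarrow> bool"
  for G d \<Psi> where
  last: "relative_state G d \<Psi> A B \<phi> = Some \<rho> \<Longrightarrow>
         iterated_relative_state G d \<Psi> [A, B] \<phi> \<rho>"
| step: "relative_state G d \<Psi> A B \<phi> = Some \<sigma> \<Longrightarrow> pure_with_vector d {B} \<sigma> \<xi> \<Longrightarrow>
         iterated_relative_state G d \<Psi> (B # C # As) \<xi> \<rho> \<Longrightarrow>
         iterated_relative_state G d \<Psi> (A # B # C # As) \<phi> \<rho>"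


section \<open>Independence of the relative state of the surface\<close>

lemma spacelike_surface_subset: "spacelike_surface G S \<Longrightarrow> S \<subseteq> edges G"
  by (induction rule: spacelike_surface.induct) (auto simp: outputs_def)

lemma finite_basis: "finite A \<Longrightarrow> finite (basis d A)"
  by (simp add: basis_def finite_PiE)

lemma merge_in_basis:
  "x \<in> basis d T \<Longrightarrow> z \<in> basis d R \<Longrightarrow> merge T R (x, z) \<in> basis d (T \<union> R)"
  by (auto simp: basis_def merge_def PiE_iff extensional_def)

lemma merge_assoc: "merge (T \<union> R) Q (merge T R (x, z), w) = merge T (R \<union> Q) (x, merge R Q (z, w))"
  by (auto simp: merge_def fun_eq_iff)

lemma sum_basis_union:
  fixes f :: "('e \<Rightarrow> nat) \<Rightarrow> complex"
  assumes "R \<inter> Q = {}"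
  shows "(\<Sum>u\<in>basis d (R \<union> Q). f u) = (\<Sum>z\<in>basis d R. \<Sum>w\<in>basis d Q. f (merge R Q (z, w)))"
proof -
  have "bij_betw (merge R Q) (basis d R \<times> basis d Q) (basis d (R \<union> Q))"
  proof (rule bij_betw_byWitness[where f' = "\<lambda>u. (restrict u R, restrict u Q)"])
    show "\<forall>a\<in>basis d R \<times> basis d Q. (restrict (merge R Q a) R, restrict (merge R Q a) Q) = a"
      using assms by (auto simp: basis_def merge_def PiE_iff extensional_def fun_eq_iff)
    show "\<forall>u\<in>basis d (R \<union> Q). merge R Q (restrict u R, restrict u Q) = u"
      by (auto simp: basis_def merge_def PiE_iff extensional_def fun_eq_iff)
    show "merge R Q ` (basis d R \<times> basis d Q) \<subseteq> basis d (R \<union> Q)"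
      using merge_in_basis by fastforce
    show "(\<lambda>u. (restrict u R, restrict u Q)) ` basis d (R \<union> Q) \<subseteq> basis d R \<times> basis d Q"
      by (auto simp: basis_def PiE_iff extensional_def)
  qed
  from sum.reindex_bij_betw[OF this, of f] show ?thesis
    by (simp add: sum.cartesian_product)
qed

lemma partial_trace_partial_trace:
  assumes "R \<inter> Q = {}"
  shows "partial_trace d T R (partial_trace d (T \<union> R) Q M) = partial_trace d T (R \<union> Q) M"
  by (auto simp: partial_trace_def fun_eq_iff sum_basis_union[OF assms] merge_assoc merge_in_basis
      intro!: sum.cong)

lemma reduced_density_mono:
  assumes "U \<subseteq> T" "T \<subseteq> S"
  shows "reduced_density d S \<psi> U = partial_trace d U (T - U) (reduced_density d S \<psi> T)"
proof -
  have "U \<union> (T - U) = T" "(T - U) \<union> (S - T) = S - U" "(T - U) \<inter> (S - T) = {}"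
    using assms by auto
  with partial_trace_partial_trace[of "T - U" "S - T" d U "ketbra \<psi> \<psi>"] show ?thesis
    by (simp add: reduced_density_def)
qed

lemma relative_operator_reduced_density:
  assumes "finite S" "A \<in> S" "B \<in> S" "A \<noteq> B"
  shows "relative_operator d S \<psi> A B \<phi> = (\<lambda>x y.
     if x \<in> basis d {B} \<and> y \<in> basis d {B}
     then \<Sum>a\<in>basis d {A}. \<Sum>b\<in>basis d {A}. cnj (\<phi> a) * \<phi> b *
       reduced_density d S \<psi> {A, B} (merge {A} {B} (a, x)) (merge {A} {B} (b, y)) else 0)"
proof (intro ext)
  fix x y
  let ?R = "S - {A, B}" and ?m = "\<lambda>a x z. merge {A, B} (S - {A, B}) (merge {A} {B} (a, x), z)"
  have S: "S - {A} = {B} \<union> ?R" using assms by auto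
  have m: "merge {A} (S - {A}) (a, merge {B} ?R (x, z)) = ?m a x z" for a x z
    using merge_assoc[of "{A}" "{B}" ?R a x z] by (simp add: S insert_commute)
  have AB: "{A} \<union> {B} = {A, B}" by auto
  show "relative_operator d S \<psi> A B \<phi> x y = (if x \<in> basis d {B} \<and> y \<in> basis d {B}
     then \<Sum>a\<in>basis d {A}. \<Sum>b\<in>basis d {A}. cnj (\<phi> a) * \<phi> b *
       reduced_density d S \<psi> {A, B} (merge {A} {B} (a, x)) (merge {A} {B} (b, y)) else 0)"
  proof (cases "x \<in> basis d {B} \<and> y \<in> basis d {B}")
    case True
    have bra: "apply_bra d S A \<phi> \<psi> (merge {B} ?R (u, z)) = (\<Sum>a\<in>basis d {A}. cnj (\<phi> a) * \<psi> (?m a u z))"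
      if "u \<in> basis d {B}" "z \<in> basis d ?R" for u z
      using merge_in_basis[OF that] by (simp add: apply_bra_def m) (simp add: S)
    have "relative_operator d S \<psi> A B \<phi> x y =
        (\<Sum>z\<in>basis d ?R. (\<Sum>a\<in>basis d {A}. cnj (\<phi> a) * \<psi> (?m a x z)) *
           cnj (\<Sum>b\<in>basis d {A}. cnj (\<phi> b) * \<psi> (?m b y z)))"
      using True by (simp add: relative_operator_def partial_trace_def ketbra_def bra cong: sum.cong)
    also have "\<dots> = (\<Sum>z\<in>basis d ?R. \<Sum>a\<in>basis d {A}. \<Sum>b\<in>basis d {A}.
        cnj (\<phi> a) * \<phi> b * (\<psi> (?m a x z) * cnj (\<psi> (?m b y z))))"
      unfolding cnj_sum sum_product by (simp add: mult_ac)
    also have "\<dots> = (\<Sum>a\<in>basis d {A}. \<Sum>b\<in>basis d {A}. cnj (\<phi> a) * \<phi> b *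
        (\<Sum>z\<in>basis d ?R. \<psi> (?m a x z) * cnj (\<psi> (?m b y z))))"
      by (subst sum.swap, rule sum.cong[OF refl], subst sum.swap) (simp add: sum_distrib_left)
    also have "\<dots> = (\<Sum>a\<in>basis d {A}. \<Sum>b\<in>basis d {A}. cnj (\<phi> a) * \<phi> b *
       reduced_density d S \<psi> {A, B} (merge {A} {B} (a, x)) (merge {A} {B} (b, y)))"
      using True merge_in_basis[of _ d "{A}" _ "{B}"] unfolding AB
      by (intro sum.cong refl) (simp add: reduced_density_def partial_trace_def ketbra_def)
    finally show ?thesis using True by simp
  qed (auto simp: relative_operator_def partial_trace_def)
qed

lemma relative_state_eq:
  assumes "is_causal_structure G" "consistent_state_assignment G d \<Psi>"
    and S: "spacelike_surface G S" "A \<in> S" "B \<in> S" and "A \<noteq> B"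
  shows "relative_state G d \<Psi> A B \<phi> =
         normalize_trace d {B} (relative_operator d S (\<Psi> S) A B \<phi>)"
proof -
  define S' where "S' = (SOME S. spacelike_surface G S \<and> A \<in> S \<and> B \<in> S)"
  have S': "spacelike_surface G S'" "A \<in> S'" "B \<in> S'"
    using someI[of "\<lambda>S. spacelike_surface G S \<and> A \<in> S \<and> B \<in> S" S] S by (auto simp: S'_def)
  have fin: "finite S" "finite S'"
    using assms(1) spacelike_surface_subset[OF S(1)] spacelike_surface_subset[OF S'(1)]
    by (auto simp: is_causal_structure_def intro: finite_subset)
  have "reduced_density d S (\<Psi> S) (S \<inter> S') = reduced_density d S' (\<Psi> S') (S \<inter> S')"
    using assms(2) S(1) S'(1) unfolding consistent_state_assignment_def by blast
  hence "reduced_density d S (\<Psi> S) {A, B} = reduced_density d S' (\<Psi> S') {A, B}"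
    using reduced_density_mono[of "{A, B}" "S \<inter> S'" S d "\<Psi> S"]
      reduced_density_mono[of "{A, B}" "S \<inter> S'" S' d "\<Psi> S'"] S S' by simp
  hence "relative_operator d S (\<Psi> S) A B \<phi> = relative_operator d S' (\<Psi> S') A B \<phi>"
    by (simp only: relative_operator_reduced_density[OF fin(1) S(2,3) \<open>A \<noteq> B\<close>]
        relative_operator_reduced_density[OF fin(2) S'(2,3) \<open>A \<noteq> B\<close>])
  thus ?thesis by (simp add: relative_state_def S'_def[symmetric])
qed

end

theory Submission
  imports Defs
begin

text \<open>
  Take four qubit edges and two vertices, \<open>0\<close> (with edge \<open>0\<close> in and edge \<open>2\<close> out) and \<open>1\<close> (with
  edge \<open>1\<close> in and edge \<open>3\<close> out), so that the surfaces are \<open>{0, 1}\<close>, \<open>{1, 2}\<close>, \<open>{2, 3}\<close> and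
  \<open>{0, 3}\<close>. Distinct surfaces share at most one edge, so putting any maximally entangled
  state on each surface is consistent: every one-edge marginal is maximally mixed. The relative
  states around the resulting 4-cycle of surfaces are therefore unconstrained. With perfect
  correlation on the first three surfaces and perfect anticorrelation on \<open>{0, 3}\<close>, the state
  \<open>|0\<rangle>\<close> of edge \<open>0\<close> is sent to \<open>|0\<rangle>\<close> along the path \<open>0, 1, 2, 3\<close> but directly to \<open>|1\<rangle>\<close>.
\<close>

section \<open>Basis vectors and maximally entangled pairs of qubits\<close>

definition label :: "'e \<Rightarrow> nat \<Rightarrow> 'e \<Rightarrow> nat" where
  "label a k = (\<lambda>i\<in>{a}. k)"

definition ket :: "'e \<Rightarrow> nat \<Rightarrow> 'e vector" where
  "ket a k = (\<lambda>x. if x = label a k then 1 else 0)"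

abbreviation qubits :: "'e \<Rightarrow> nat" where
  "qubits \<equiv> \<lambda>_. 2"

text \<open>On the bits these are the identity and the flip, hence all permutations; values at
  arguments from 2 on are unconstrained.\<close>

definition bit_involution :: "(nat \<Rightarrow> nat) \<Rightarrow> bool" where
  "bit_involution f \<longleftrightarrow> (\<forall>k<2. f k < 2 \<and> f (f k) = k)"

text \<open>The maximally entangled vector, the sum of |k> on \<open>a\<close> tensor |f k> on
  \<open>b\<close> over both bits k, divided by \<open>sqrt 2\<close>.\<close>

definition bell :: "'e \<Rightarrow> 'e \<Rightarrow> (nat \<Rightarrow> nat) \<Rightarrow> 'e vector" where
  "bell a b f = (\<lambda>x. if x \<in> basis qubits {a, b} \<and> x b = f (x a) then complex_of_real (1 / sqrt 2) else 0)"

lemma label_apply [simp]: "label a k a = k"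
  by (simp add: label_def)

lemma label_eq_iff [simp]: "label a k = label a l \<longleftrightarrow> k = l"
  by (metis label_apply)

lemma basis_singleton: "basis d {a} = label a ` {..<d a}"
proof (intro set_eqI iffI)
  fix x assume "x \<in> basis d {a}"
  hence "x = label a (x a)" "x a < d a"
    by (auto simp: basis_def label_def PiE_iff extensional_def fun_eq_iff)
  thus "x \<in> label a ` {..<d a}" by blast
qed (auto simp: basis_def label_def PiE_iff extensional_def)

lemma sum_basis_singleton: "(\<Sum>x\<in>basis d {a}. g x) = (\<Sum>k<d a. g (label a k))"
  unfolding basis_singleton by (subst sum.reindex) (auto simp: inj_on_def)

lemma basis_empty: "basis d {} = {\<lambda>_. undefined}"
  by (simp add: basis_def)

lemma complex_sqrt_two [simp]:
  "complex_of_real (sqrt 2) * complex_of_real (sqrt 2) = 2" "(complex_of_real (sqrt 2))\<^sup>2 = 2"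
  by (simp_all flip: of_real_mult of_real_power)

lemma merge_label:
  "a \<noteq> b \<Longrightarrow> merge {a} {b} (label a i, label b j) a = i"
  "a \<noteq> b \<Longrightarrow> merge {a} {b} (label a i, label b j) b = j"
  by (auto simp: merge_def)

lemma bell_merge:
  assumes "a \<noteq> b" "i < 2" "j < 2"
  shows "bell a b f (merge {a} {b} (label a i, label b j)) =
    (if j = f i then complex_of_real (1 / sqrt 2) else 0)"
proof -
  have "merge {a} {b} (label a i, label b j) \<in> basis qubits ({a} \<union> {b})"
    using assms by (intro merge_in_basis) (auto simp: basis_singleton)
  thus ?thesis using assms by (simp add: bell_def merge_label insert_commute)
qed

text \<open>A self-inverse \<open>f\<close> makes the correlation symmetric. Facts about the first
  edge of a pair thus carry over to the second.\<close>

lemma bell_commute: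
  assumes "bit_involution f"
  shows "bell a b f = bell b a f"
proof -
  have "x b = f (x a) \<longleftrightarrow> x a = f (x b)" if "x \<in> basis qubits {a, b}" for x
  proof -
    have "x a < 2" "x b < 2" using that by (auto simp: basis_def PiE_iff)
    thus ?thesis using assms by (metis bit_involution_def)
  qed
  hence "(x \<in> basis qubits {a, b} \<and> x b = f (x a)) = (x \<in> basis qubits {b, a} \<and> x a = f (x b))" for x
    by (metis insert_commute)
  thus ?thesis unfolding bell_def by presburger
qed

section \<open>Norms and marginals of entangled pairs\<close>

lemma unit_vector_ket: "k < d a \<Longrightarrow> unit_vector d {a} (ket a k)"
  by (auto simp: unit_vector_def hilbert_def sum_basis_singleton ket_def basis_singleton
      if_distrib[of cmod] if_distrib[of "\<lambda>x. x\<^sup>2"] cong: if_cong)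

lemma unit_vector_bell:
  assumes "bit_involution f" "a \<noteq> b"
  shows "unit_vector qubits {a, b} (bell a b f)"
proof -
  have f: "f i < 2" if "i < 2" for i using assms that by (simp add: bit_involution_def)
  \<comment> \<open>The real sum is cast to complex numbers because \<open>sum_basis_union\<close>
    is stated for complex summands. \<open>merge_singleton\<close> is disabled since it would
    rewrite the labels that \<open>bell_merge\<close> has to match.\<close>
  have "(\<Sum>x\<in>basis qubits ({a} \<union> {b}). complex_of_real ((cmod (bell a b f x))\<^sup>2)) =
      (\<Sum>i<2. \<Sum>j<2. complex_of_real (if j = f i then 1 / 2 else 0))"
    using assms(2) by (subst sum_basis_union)
      (auto simp: sum_basis_singleton bell_merge norm_divide power_divide simp del: merge_singleton
        intro!: sum.cong)
  also have "\<dots> = complex_of_real 1"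
    using f by (simp add: sum.delta flip: of_real_sum)
  finally have "(\<Sum>x\<in>basis qubits {a, b}. (cmod (bell a b f x))\<^sup>2) = 1"
    unfolding of_real_sum[symmetric] of_real_eq_iff by (simp add: insert_commute)
  thus ?thesis by (auto simp: unit_vector_def hilbert_def bell_def)
qed

text \<open>Tracing out \<open>b\<close> kills the off-diagonal entries because \<open>f\<close> is
  injective on bits. The result does not depend on \<open>f\<close>, so a twist is invisible on a
  single edge.\<close>

lemma reduced_density_bell:
  assumes "bit_involution f" "a \<noteq> b"
  shows "reduced_density qubits {a, b} (bell a b f) {a} =
    (\<lambda>x y. if x \<in> basis qubits {a} \<and> y = x then 1 / 2 else 0)"
proof (intro ext)
  fix x y :: "'a \<Rightarrow> nat"
  have f: "f i < 2" if "i < 2" for i using assms that by (simp add: bit_involution_def)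
  have inj: "f i = f j \<longleftrightarrow> i = j" if "i < 2" "j < 2" for i j
    using assms that by (metis bit_involution_def)
  have S: "{a, b} - {a} = {b}" using assms by auto
  show "reduced_density qubits {a, b} (bell a b f) {a} x y =
    (if x \<in> basis qubits {a} \<and> y = x then 1 / 2 else 0)"
  proof (cases "x \<in> basis qubits {a} \<and> y \<in> basis qubits {a}")
    case True
    then obtain i j where ij: "x = label a i" "y = label a j" "i < 2" "j < 2"
      by (auto simp: basis_singleton)
    have "reduced_density qubits {a, b} (bell a b f) {a} x y =
        (\<Sum>k<2. bell a b f (merge {a} {b} (label a i, label b k)) *
           cnj (bell a b f (merge {a} {b} (label a j, label b k))))"
      using True by (simp add: reduced_density_def partial_trace_def S sum_basis_singleton ketbra_def ij)
    also have "\<dots> = (\<Sum>k<2. if k = f i then (if i = j then 1 / 2 else 0) else 0)"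
      using assms(2) ij by (intro sum.cong) (auto simp: bell_merge inj simp del: merge_singleton)
    also have "\<dots> = (if i = j then 1 / 2 else 0)" using f[OF ij(3)] by simp
    finally show ?thesis using True ij by auto
  qed (auto simp: reduced_density_def partial_trace_def)
qed

text \<open>Tracing out everything leaves the squared norm, a scalar on the one-dimensional space of
  \<open>{}\<close>. This settles disjoint surfaces.\<close>

lemma reduced_density_empty:
  assumes "unit_vector d S \<psi>"
  shows "reduced_density d S \<psi> {} =
    (\<lambda>x y. if x = (\<lambda>_. undefined) \<and> y = (\<lambda>_. undefined) then 1 else 0)"
proof -
  have m: "merge {} S (\<lambda>_. undefined, z) = z" if "z \<in> basis d S" for z
    using that by (auto simp: merge_def basis_def PiE_iff extensional_def)
  have "(\<Sum>z\<in>basis d S. \<psi> z * cnj (\<psi> z)) = complex_of_real (\<Sum>x\<in>basis d S. (cmod (\<psi> x))\<^sup>2)"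
    by (simp add: complex_norm_square del: of_real_power)
  also have "\<dots> = 1" using assms by (simp add: unit_vector_def del: of_real_sum)
  finally have "(\<Sum>z\<in>basis d S. ketbra \<psi> \<psi> (merge {} S (\<lambda>_. undefined, z))
      (merge {} S (\<lambda>_. undefined, z))) = 1"
    by (simp add: ketbra_def m cong: sum.cong)
  thus ?thesis
    unfolding reduced_density_def partial_trace_def basis_empty singleton_iff Diff_empty
    by (intro ext) (simp split: if_split)
qed

section \<open>Relative states of one entangled pair\<close>

lemma apply_bra_ket_bell:
  assumes "bit_involution f" "a \<noteq> b" "k < 2"
  shows "apply_bra qubits {a, b} a (ket a k) (bell a b f) =
    (\<lambda>x. complex_of_real (1 / sqrt 2) * ket b (f k) x)"
proof
  fix x :: "'a \<Rightarrow> nat"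
  have f: "f k < 2" using assms by (simp add: bit_involution_def)
  have S: "{a, b} - {a} = {b}" using assms by auto
  show "apply_bra qubits {a, b} a (ket a k) (bell a b f) x =
    complex_of_real (1 / sqrt 2) * ket b (f k) x"
  proof (cases "x \<in> basis qubits {b}")
    case True
    then obtain j where j: "x = label b j" "j < 2" by (auto simp: basis_singleton)
    \<comment> \<open>The bra of \<open>ket a k\<close> keeps only the summand with i = k, and that
      one is nonzero only at j = f k.\<close>
    have "apply_bra qubits {a, b} a (ket a k) (bell a b f) x =
        (\<Sum>i<2. if i = k then bell a b f (merge {a} {b} (label a i, label b j)) else 0)"
      using True unfolding apply_bra_def S sum_basis_singleton if_P[OF True]
      by (intro sum.cong) (auto simp: ket_def j)
    also have "\<dots> = (if j = f k then complex_of_real (1 / sqrt 2) else 0)"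
      using assms j by (simp add: bell_merge del: merge_singleton)
    finally show ?thesis by (simp add: j ket_def)
  next
    case False
    with f show ?thesis by (auto simp: apply_bra_def S ket_def basis_singleton)
  qed
qed

lemma normalized_relative_operator_bell:
  assumes "bit_involution f" "a \<noteq> b" "k < 2"
  shows "normalize_trace qubits {b} (relative_operator qubits {a, b} (bell a b f) a b (ket a k)) =
    Some (ketbra (ket b (f k)) (ket b (f k)))"
proof -
  have f: "f k < 2" using assms by (simp add: bit_involution_def)
  \<comment> \<open>No edge besides \<open>a\<close> and \<open>b\<close> remains to be traced out,
    so the partial trace has a single term.\<close>
  have m: "merge {b} {} (x, z) = x" if "x \<in> basis qubits {b}" for x z
    using that by (auto simp: merge_def basis_def PiE_iff extensional_def)
  have M: "relative_operator qubits {a, b} (bell a b f) a b (ket a k) =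
      (\<lambda>x y. ketbra (ket b (f k)) (ket b (f k)) x y / 2)"
    using f unfolding relative_operator_def apply_bra_ket_bell[OF assms]
    by (auto simp: partial_trace_def basis_empty ketbra_def m fun_eq_iff ket_def basis_singleton)
  have tr: "op_trace qubits {b} (\<lambda>x y. ketbra (ket b (f k)) (ket b (f k)) x y / 2) = 1 / 2"
  proof -
    have "op_trace qubits {b} (\<lambda>x y. ketbra (ket b (f k)) (ket b (f k)) x y / 2) =
        (\<Sum>j<2. if j = f k then 1 / 2 else 0)"
      unfolding op_trace_def sum_basis_singleton by (intro sum.cong) (auto simp: ketbra_def ket_def)
    thus ?thesis using f by simp
  qed
  \<comment> \<open>A nonzero entry excludes the undefined branch of \<open>normalize_trace\<close>;
    dividing by the trace 1/2 then cancels the factor 1/2.\<close>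
  have "ketbra (ket b (f k)) (ket b (f k)) (label b (f k)) (label b (f k)) / 2 \<noteq> 0"
    by (simp add: ketbra_def ket_def)
  hence "(\<lambda>x y. ketbra (ket b (f k)) (ket b (f k)) x y / 2) \<noteq> (\<lambda>x y. 0)" by metis
  thus ?thesis unfolding M normalize_trace_def tr by simp
qed

section \<open>The causal structure and its four surfaces\<close>

definition square :: "(nat, nat) causal_structure" where
  "square = \<lparr>verts = {0, 1}, edges = {0, 1, 2, 3},
     source = (\<lambda>e. if e = 2 then Some 0 else if e = 3 then Some 1 else None),
     target = (\<lambda>e. if e = 0 then Some 0 else if e = 1 then Some 1 else None)\<rparr>"

text \<open>\<open>Min\<close> and \<open>Max\<close> recover the two edges from the set and fix
  their order for \<open>bell\<close>.\<close>

definition twisted_assignment :: "nat set \<Rightarrow> nat vector" where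
  "twisted_assignment S = bell (Min S) (Max S) (if S = {0, 3} then (\<lambda>k. 1 - k) else id)"

lemma is_causal_structure_square: "is_causal_structure square"
proof -
  \<comment> \<open>No edge has both a source and a target, so the relation to be acyclic is
    empty.\<close>
  have "{(u, v). \<exists>e\<in>edges square. source square e = Some u \<and> target square e = Some v} = {}"
    by (auto simp: square_def split: if_splits)
  thus ?thesis by (auto simp: is_causal_structure_def acyclic_def square_def split: if_splits)
qed

lemma square_inputs_outputs:
  "inputs square 0 = {0}" "inputs square 1 = {1}"
  "outputs square 0 = {2}" "outputs square 1 = {3}"
  by (auto simp: inputs_def outputs_def square_def split: if_splits)

lemma spacelike_surface_square:
  "spacelike_surface square S \<longleftrightarrow> S \<in> {{0, 1}, {1, 2}, {0, 3}, {2, 3}}"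
proof
  assume "spacelike_surface square S"
  thus "S \<in> {{0, 1}, {1, 2}, {0, 3}, {2, 3}}"
  proof induction
    case initial
    have "{e \<in> edges square. source square e = None} = {0, 1}"
      by (auto simp: square_def split: if_splits)
    thus ?case by simp
  next
    case (step S v)
    have "v = 0 \<or> v = 1" using step by (auto simp: square_def)
    \<comment> \<open>The list of four sets is closed under both vertex moves. Without
      \<open>One_nat_def\<close> the vertex 1 stays in the form that
      \<open>square_inputs_outputs\<close> matches.\<close>
    with step show ?case
      by (elim disjE insertE emptyE) (auto simp: square_inputs_outputs simp del: One_nat_def)
  qed
next
  have s: "0 \<in> verts square" "1 \<in> verts square" by (auto simp: square_def)
  have "{e \<in> edges square. source square e = None} = {0, 1}"
    by (auto simp: square_def split: if_splits)
  hence 01: "spacelike_surface square {0, 1}"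
    using spacelike_surface.initial[of square] by simp
  have 12: "spacelike_surface square {1, 2}"
    using spacelike_surface.step[OF 01 s(1)] unfolding square_inputs_outputs
    by (simp add: insert_Diff_if insert_commute)
  have 03: "spacelike_surface square {0, 3}"
    using spacelike_surface.step[OF 01 s(2)] unfolding square_inputs_outputs
    by (simp add: insert_Diff_if insert_commute)
  have 23: "spacelike_surface square {2, 3}"
    using spacelike_surface.step[OF 12 s(2)] unfolding square_inputs_outputs
    by (simp add: insert_Diff_if insert_commute)
  assume "S \<in> {{0, 1}, {1, 2}, {0, 3}, {2, 3}}"
  with 01 12 03 23 show "spacelike_surface square S" by auto
qed

lemma bit_involution_id: "bit_involution id"
  by (simp add: bit_involution_def)

lemma bit_involution_flip: "bit_involution (\<lambda>k. 1 - k)"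
  by (auto simp: bit_involution_def)

text \<open>Hides which surface is twisted, so that norms and one-edge marginals are treated
  uniformly.\<close>

lemma surface_cases:
  assumes "spacelike_surface square S"
  obtains a b f where "S = {a, b}" "a < b" "bit_involution f" "twisted_assignment S = bell a b f"
proof -
  have f: "bit_involution (if S = {0, 3} then (\<lambda>k. 1 - k) else id)"
    using bit_involution_id bit_involution_flip by presburger
  \<comment> \<open>Saved under another name because the next claim rebinds
    \<open>that\<close>.\<close>
  note witness = that
  have *: thesis if "S = {a, b}" "a < b" for a b
    using that f by (intro witness[OF that, of "if S = {0, 3} then (\<lambda>k. 1 - k) else id"])
      (simp_all add: twisted_assignment_def)
  show thesis
    using assms(1)[unfolded spacelike_surface_square]
    by (elim insertE emptyE) (erule *, simp)+
qed

section \<open>Consistency of the twisted assignment\<close>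

lemma unit_vector_twisted_assignment:
  "spacelike_surface square S \<Longrightarrow> unit_vector qubits S (twisted_assignment S)"
  by (erule surface_cases) (simp add: unit_vector_bell)

lemma reduced_density_twisted_assignment:
  assumes "spacelike_surface square S" "e \<in> S"
  shows "reduced_density qubits S (twisted_assignment S) {e} =
    (\<lambda>x y. if x \<in> basis qubits {e} \<and> y = x then 1 / 2 else 0)"
  using assms(1)
proof (cases rule: surface_cases)
  case (1 a b f)
  \<comment> \<open>The swapped form covers the case that \<open>e\<close> is the larger
    edge.\<close>
  then have "twisted_assignment S = bell b a f" "S = {b, a}" by (auto intro: bell_commute)
  with 1 assms(2) show ?thesis
    using reduced_density_bell[of f a b] reduced_density_bell[of f b a] by auto
qed

lemma consistent_twisted_assignment: "consistent_state_assignment square qubits twisted_assignment"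
  unfolding consistent_state_assignment_def
proof (intro conjI ballI allI impI)
  fix v assume "v \<in> verts square"
  hence "v = 0 \<or> v = 1" by (auto simp: square_def)
  thus "(\<Prod>e\<in>inputs square v. 2::nat) = (\<Prod>e\<in>outputs square v. 2)"
    by (elim disjE) (simp_all only: square_inputs_outputs, simp_all)
next
  fix S assume "spacelike_surface square S"
  thus "unit_vector qubits S (twisted_assignment S)"
    by (rule unit_vector_twisted_assignment)
next
  fix S S' assume S: "spacelike_surface square S" and S': "spacelike_surface square S'"
  \<comment> \<open>Distinct surfaces never share a pair of edges, so no correlations are compared:
    only norms, or the maximally mixed state of one edge.\<close>
  consider "S = S'" | "S \<inter> S' = {}" | e where "S \<inter> S' = {e}"
  proof -
    have "S = S' \<or> S \<inter> S' = {} \<or> (\<exists>e\<in>{0, 1, 2, 3}. S \<inter> S' = {e})"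
      using S S' unfolding spacelike_surface_square by (elim insertE emptyE) simp_all
    thus thesis using that by blast
  qed
  thus "reduced_density qubits S (twisted_assignment S) (S \<inter> S') =
      reduced_density qubits S' (twisted_assignment S') (S \<inter> S')"
  proof cases
    case 2
    with unit_vector_twisted_assignment[OF S] unit_vector_twisted_assignment[OF S'] show ?thesis
      by (simp add: reduced_density_empty)
  next
    case (3 e)
    hence "e \<in> S" "e \<in> S'" by auto
    with 3 reduced_density_twisted_assignment[OF S] reduced_density_twisted_assignment[OF S']
    show ?thesis by simp
  qed simp
qed

section \<open>Relative states around the cycle and the contradiction\<close>

lemma relative_state_square:
  assumes "spacelike_surface square {a, b}" "a < b" "k < 2"
    and f: "f = (if {a, b} = {0, 3} then (\<lambda>k. 1 - k) else id)"
  shows "relative_state square qubits twisted_assignment a b (ket a k) =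
    Some (ketbra (ket b (f k)) (ket b (f k)))"
proof -
  \<comment> \<open>The flip is supplied in simplified form because the simplifier also rewrites the
    1 in the goal to \<open>Suc 0\<close>.\<close>
  have "bit_involution f" by (simp add: f bit_involution_id bit_involution_flip[simplified])
  moreover have "twisted_assignment {a, b} = bell a b f"
    using assms(2) by (simp add: twisted_assignment_def f)
  ultimately show ?thesis
    using relative_state_eq[OF is_causal_structure_square consistent_twisted_assignment assms(1)]
      normalized_relative_operator_bell[of f a b k] assms(2,3) by simp
qed

theorem mainTheorem1:
  shows "\<exists>(G :: (nat, nat) causal_structure) (d :: nat \<Rightarrow> nat) (\<Psi> :: nat set \<Rightarrow> nat vector)
            (As :: nat list) (\<phi> :: nat vector) (\<rho> :: nat oper) (\<rho>' :: nat oper).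
           is_causal_structure G \<and>
           consistent_state_assignment G d \<Psi> \<and>
           2 \<le> length As \<and>
           set As \<subseteq> edges G \<and>
           (\<forall>i. i + 1 < length As \<longrightarrow> As ! i \<noteq> As ! (i + 1)) \<and>
           hd As \<noteq> last As \<and>
           (\<forall>i. i + 1 < length As \<longrightarrow>
              (\<exists>S. spacelike_surface G S \<and> As ! i \<in> S \<and> As ! (i + 1) \<in> S)) \<and>
           (\<exists>S. spacelike_surface G S \<and> hd As \<in> S \<and> last As \<in> S) \<and>
           \<phi> \<in> hilbert d {hd As} \<and>
           iterated_relative_state G d \<Psi> As \<phi> \<rho> \<and>
           pure d {last As} \<rho> \<and>
           relative_state G d \<Psi> (hd As) (last As) \<phi> = Some \<rho>' \<and>
           \<rho> \<noteq> \<rho>'"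
proof -
  let ?\<rho> = "\<lambda>k. ketbra (ket 3 k) (ket 3 k) :: nat oper"
  have surf: "spacelike_surface square {0, 1}" "spacelike_surface square {1, 2}"
    "spacelike_surface square {2, 3}" "spacelike_surface square {0, 3}"
    by (simp_all add: spacelike_surface_square)
  have pure: "pure_with_vector qubits {a} (ketbra (ket a 0) (ket a 0)) (ket a 0)" for a :: nat
    by (simp add: pure_with_vector_def unit_vector_ket)
  \<comment> \<open>These decide the conditional in \<open>relative_state_square\<close>: the three
    path surfaces use \<open>id\<close>, and only \<open>{0, 3}\<close> uses the flip.\<close>
  have straight: "{0, 1} \<noteq> {0, 3 :: nat}" "{1, 2} \<noteq> {0, 3 :: nat}" "{2, 3} \<noteq> {0, 3 :: nat}"
    by (simp_all add: doubleton_eq_iff)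
  have rel:
    "relative_state square qubits twisted_assignment 0 1 (ket 0 0) = Some (ketbra (ket 1 0) (ket 1 0))"
    "relative_state square qubits twisted_assignment 1 2 (ket 1 0) = Some (ketbra (ket 2 0) (ket 2 0))"
    "relative_state square qubits twisted_assignment 2 3 (ket 2 0) = Some (?\<rho> 0)"
    "relative_state square qubits twisted_assignment 0 3 (ket 0 0) = Some (?\<rho> 1)"
    using relative_state_square[OF surf(1) _ _ refl, of 0, unfolded if_not_P[OF straight(1)]]
      relative_state_square[OF surf(2) _ _ refl, of 0, unfolded if_not_P[OF straight(2)]]
      relative_state_square[OF surf(3) _ _ refl, of 0, unfolded if_not_P[OF straight(3)]]
      relative_state_square[OF surf(4) _ _ refl, of 0, unfolded if_P[OF refl]]
    unfolding id_apply diff_zero by simp_all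
  have iter: "iterated_relative_state square qubits twisted_assignment [0, 1, 2, 3] (ket 0 0) (?\<rho> 0)"
    by (intro iterated_relative_state.step[OF rel(1) pure] iterated_relative_state.step[OF rel(2) pure]
        iterated_relative_state.last[OF rel(3)])
  \<comment> \<open>The diagonal entry at bit 0 of edge 3 is 1 along the path and 0 for the direct
    map.\<close>
  have "?\<rho> 0 (label 3 0) (label 3 0) \<noteq> ?\<rho> 1 (label 3 0) (label 3 0)"
    by (simp add: ketbra_def ket_def)
  hence neq: "?\<rho> 0 \<noteq> ?\<rho> 1" by metis
  have adj: "\<exists>S. spacelike_surface square S \<and> [0, 1, 2, 3] ! i \<in> S \<and> [0, 1, 2, 3] ! (i + 1) \<in> S"
    "[0, 1, 2, 3 :: nat] ! i \<noteq> [0, 1, 2, 3] ! (i + 1)"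
    if "i + 1 < length [0, 1, 2, 3 :: nat]" for i
  proof -
    have i: "i = 0 \<or> i = 1 \<or> i = 2" using that by auto
    show "\<exists>S. spacelike_surface square S \<and> [0, 1, 2, 3] ! i \<in> S \<and> [0, 1, 2, 3] ! (i + 1) \<in> S"
      using i surf(1-3) by (elim disjE) force+
    show "[0, 1, 2, 3 :: nat] ! i \<noteq> [0, 1, 2, 3] ! (i + 1)"
      using i by (elim disjE) simp_all
  qed
  show ?thesis
  proof (rule exI[of _ square], rule exI[of _ qubits], rule exI[of _ twisted_assignment],
      rule exI[of _ "[0, 1, 2, 3]"], rule exI[of _ "ket 0 0"], rule exI[of _ "?\<rho> 0"],
      rule exI[of _ "?\<rho> 1"], intro conjI)
    show "\<forall>i. i + 1 < length [0, 1, 2, 3 :: nat] \<longrightarrow> [0, 1, 2, 3 :: nat] ! i \<noteq> [0, 1, 2, 3] ! (i + 1)"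
      using adj(2) by blast
    show "\<forall>i. i + 1 < length [0, 1, 2, 3 :: nat] \<longrightarrow>
        (\<exists>S. spacelike_surface square S \<and> [0, 1, 2, 3] ! i \<in> S \<and> [0, 1, 2, 3] ! (i + 1) \<in> S)"
      using adj(1) by blast
    show "\<exists>S. spacelike_surface square S \<and> hd [0, 1, 2, 3] \<in> S \<and> last [0, 1, 2, 3] \<in> S"
      using surf(4) by force
    show "ket 0 0 \<in> hilbert qubits {hd [0, 1, 2, 3 :: nat]}"
      using unit_vector_ket[of 0 qubits "0 :: nat"] by (simp add: unit_vector_def)
    show "pure qubits {last [0, 1, 2, 3 :: nat]} (?\<rho> 0)"
      using pure[of 3] by (auto simp: pure_def)
  qed (use is_causal_structure_square consistent_twisted_assignment iter neq rel(4)
      in \<open>simp_all add: square_def\<close>)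
qed

end
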